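(* Let $F>0$ and let $C,P:\mathbb{R}\to\mathbb{R}$ be call and put price functions of the strike satisfying the static no-arbitrage conditions in the normal setting listed in the context. Let $K_1<K_2$ be real strikes and, for $i=1,2$, let $\sigma_i=\sigma(K_i)>0$ be the Bachelier implied volatility at $K_i$. Then $$\frac{K_1-F}{\sigma_1}<\frac{K_2-F}{\sigma_2}.$$ Equivalently, $x(K)=(F-K)/\sigma(K)$ is strictly decreasing in $K$.
   Context: A single maturity is fixed, the discount factor is one, and $F>0$ is the forward price. $C(K)$ and $P(K)$ are undiscounted European call and put prices with strike $K\in\mathbb{R}$. "Increasing" and "decreasing" without "strictly" are meant in the weak sense. Static no-arbitrage conditions (normal setting): (1) $C$ is decreasing and convex in $K$; (2) $P$ is increasing and convex in $K$; (3) put--call parity: $C(K)-P(K)=F-K$ for all $K$; (4) boundary conditions: $\lim_{K\to-\infty}\{C(K)-(F-K)\}=0$ and $\lim_{K\to\infty}C(K)=0$. $\phi$ and $\Phi$ are the standard normal density and distribution function. For $\sigma>0$ and $x=(F-K)/\sigma$, the Bachelier call and put prices are $$C_N(K,\sigma)=\sigma\{\phi(x)+x\Phi(x)\},\qquad P_N(K,\sigma)=\sigma\{\phi(x)-x\Phi(-x)\}.$$ The Bachelier implied volatility at strike $K$ is the number $\sigma(K)>0$ with $C_N(K,\sigma(K))=C(K)$ (equivalently, by parity, $P_N(K,\sigma(K))=P(K)$). *)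

theory Defs
  imports "HOL-Probability.Probability"
begin

definition normal_no_arbitrage :: "real \<Rightarrow> (real \<Rightarrow> real) \<Rightarrow> (real \<Rightarrow> real) \<Rightarrow> bool" where
  "normal_no_arbitrage F C P \<longleftrightarrow>
     antimono C \<and> convex_on UNIV C \<and>
     mono P \<and> convex_on UNIV P \<and>
     (\<forall>K. C K - P K = F - K) \<and>
     ((\<lambda>K. C K - (F - K)) \<longlongrightarrow> 0) at_bot \<and>
     (C \<longlongrightarrow> 0) at_top"

abbreviation std_normal_cdf :: "real \<Rightarrow> real" where
  "std_normal_cdf \<equiv> cdf std_normal_distribution"

definition bachelier_call :: "real \<Rightarrow> real \<Rightarrow> real \<Rightarrow> real" where
  "bachelier_call F K \<sigma> =
     (let x = (F - K) / \<sigma> in \<sigma> * (std_normal_density x + x * std_normal_cdf x))"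

definition is_bachelier_implied_vol :: "real \<Rightarrow> (real \<Rightarrow> real) \<Rightarrow> real \<Rightarrow> real \<Rightarrow> bool" where
  "is_bachelier_implied_vol F C K \<sigma> \<longleftrightarrow> \<sigma> > 0 \<and> bachelier_call F K \<sigma> = C K"

text \<open>The no-arbitrage conditions allow the call price to equal its intrinsic value
  \<open>max (F - K) 0\<close>, and at such strikes no positive implied volatility exists. The function
  \<open>bachelier_implied_vol F C\<close> is therefore meaningful only on the set
  \<open>implied_vol_strikes F C\<close>.\<close>

definition implied_vol_strikes :: "real \<Rightarrow> (real \<Rightarrow> real) \<Rightarrow> real set" where
  "implied_vol_strikes F C = {K. \<exists>\<sigma>. is_bachelier_implied_vol F C K \<sigma>}"

definition bachelier_implied_vol :: "real \<Rightarrow> (real \<Rightarrow> real) \<Rightarrow> real \<Rightarrow> real" where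
  "bachelier_implied_vol F C K = (THE \<sigma>. is_bachelier_implied_vol F C K \<sigma>)"

end

theory Submission
  imports Defs
begin

text \<open>With \<open>g x = \<phi> x + x \<Phi> x\<close> the Bachelier call price is \<open>\<sigma> g x\<close> and the put price is
  \<open>\<sigma> g (- x)\<close>, where \<open>x = (F - K) / \<sigma>\<close>. The function \<open>g\<close> is positive and increasing. For strikes
  above \<open>F\<close>, the ratio \<open>C K / (K - F) = g x / (- x)\<close> is strictly decreasing in the strike because
  \<open>C\<close> is decreasing and positive, while \<open>g x / (- x)\<close> increases with \<open>x < 0\<close>; hence \<open>x\<close> is strictly
  decreasing. Strikes below \<open>F\<close> are handled symmetrically with puts, and strikes on different sides
  of \<open>F\<close> by the sign of \<open>x\<close>.\<close>

interpretation std_normal: real_distribution std_normal_distribution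
  by (rule real_dist_normal_dist)

lemma DERIV_std_normal_density:
  "(std_normal_density has_real_derivative - x * std_normal_density x) (at x)"
  unfolding normal_density_def
  by (auto intro!: derivative_eq_intros simp: field_simps power2_eq_square)

lemma std_normal_density_minus [simp]: "std_normal_density (- x) = std_normal_density x"
  by (simp add: normal_density_def)

lemma tendsto_std_normal_density_at_bot: "(std_normal_density \<longlongrightarrow> 0) at_bot"
proof -
  have "filterlim (\<lambda>x::real. x\<^sup>2) at_top at_bot"
    by (intro filterlim_pow_at_bot_even filterlim_ident) auto
  then have "filterlim (\<lambda>x::real. (1/2) * x\<^sup>2) at_top at_bot"
    by (rule filterlim_tendsto_pos_mult_at_top[OF tendsto_const, rotated]) simp
  then have "filterlim (\<lambda>x::real. - ((1/2) * x\<^sup>2)) at_bot at_bot"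
    by (simp add: filterlim_uminus_at_top)
  then have "((\<lambda>x::real. exp (- ((1/2) * x\<^sup>2))) \<longlongrightarrow> 0) at_bot"
    by (rule filterlim_compose[OF exp_at_bot])
  then have "((\<lambda>x::real. (1 / sqrt (2 * pi)) * exp (- ((1/2) * x\<^sup>2))) \<longlongrightarrow> 0) at_bot"
    by (rule tendsto_mult_right_zero)
  then show ?thesis
    by (simp add: normal_density_def[abs_def])
qed

lemma std_normal_cdf_diff:
  assumes "a \<le> b"
  shows "std_normal_cdf b - std_normal_cdf a = integral {a..b} std_normal_density"
proof (cases "a < b")
  case True
  have int: "integrable lborel std_normal_density"
    by simp
  have "std_normal_cdf b - std_normal_cdf a = measure std_normal_distribution {a<..b}"
    using True by (rule std_normal.cdf_diff_eq)
  also have "\<dots> = (\<integral>x. indicator {a<..b} x \<partial>std_normal_distribution)"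
    by simp
  also have "\<dots> = (LINT x:{a<..b}|lborel. std_normal_density x)"
    by (subst integral_real_density) (auto simp: set_lebesgue_integral_def mult.commute)
  \<comment> \<open>The endpoint \<open>a\<close> is Lebesgue-null; the closed interval is the form
    that the fundamental theorem of calculus uses.\<close>
  also have "\<dots> = (LINT x:{a..b}|lborel. std_normal_density x)"
    by (rule set_integral_discrete_difference[where X="{a}"]) auto
  also have "\<dots> = integral {a..b} std_normal_density"
    by (intro set_borel_integral_eq_integral)
       (use integrable_mult_indicator[OF _ int, of "{a..b}"] in \<open>simp add: set_integrable_def\<close>)
  finally show ?thesis .
qed (use assms in auto)

lemma DERIV_std_normal_cdf: "(std_normal_cdf has_real_derivative std_normal_density x) (at x)"
proof -
  \<comment> \<open>The fundamental theorem needs a finite lower limit. Any interval with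
    \<open>x\<close> in its interior serves, so that the derivative within it is the full
    derivative.\<close>
  have cont: "continuous_on {x - 1..x + 1} std_normal_density"
    by (rule DERIV_continuous_on) (rule DERIV_subset[OF DERIV_std_normal_density subset_UNIV])
  have "((\<lambda>u. integral {x - 1..u} std_normal_density) has_real_derivative std_normal_density x)
      (at x within {x - 1..x + 1})"
    by (rule integral_has_real_derivative[OF cont]) simp
  then have "((\<lambda>u. std_normal_cdf (x - 1) + integral {x - 1..u} std_normal_density)
      has_real_derivative std_normal_density x) (at x within {x - 1..x + 1})"
    by (auto intro!: derivative_eq_intros)
  then have "(std_normal_cdf has_real_derivative std_normal_density x) (at x within {x - 1..x + 1})"
    by (rule has_field_derivative_transform_within[where d=1])
       (auto simp flip: std_normal_cdf_diff)
  then show ?thesis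
    by (simp add: at_within_Icc_at)
qed

text \<open>As the density is even, the sum of both values has derivative zero; its limit at
  infinity fixes the constant as 1.\<close>

lemma std_normal_cdf_minus: "std_normal_cdf (- x) = 1 - std_normal_cdf x"
proof -
  let ?s = "\<lambda>t. std_normal_cdf t + std_normal_cdf (- t)"
  have "(?s has_real_derivative 0) (at t)" for t
    by (rule derivative_eq_intros DERIV_std_normal_cdf
          DERIV_chain2[OF DERIV_std_normal_cdf] refl | simp)+
  then have "?s t = ?s x" for t
    by (rule DERIV_isconst_all[rule_format, of ?s])
  then obtain c where c: "?s t = c" for t
    by blast
  have "(?s \<longlongrightarrow> 1 + 0) at_top"
    by (intro tendsto_add std_normal.cdf_lim_at_top_prob
          filterlim_compose[OF std_normal.cdf_lim_at_bot filterlim_uminus_at_bot_at_top])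
  then have "c = 1"
    unfolding c by (simp add: tendsto_const_iff)
  with c[of x] show ?thesis
    by simp
qed

text \<open>The \<open>g\<close> of the overview: the mean of \<open>max (x + Z) 0\<close> for a
  standard normal \<open>Z\<close>.\<close>

definition bachelier_fun :: "real \<Rightarrow> real" where
  "bachelier_fun x = std_normal_density x + x * std_normal_cdf x"

lemma bachelier_call_eq: "bachelier_call F K \<sigma> = \<sigma> * bachelier_fun ((F - K) / \<sigma>)"
  by (simp add: bachelier_call_def bachelier_fun_def Let_def)

text \<open>Put-call parity at unit volatility; it transfers results from \<open>x < 0\<close> to
  \<open>x > 0\<close>.\<close>

lemma bachelier_fun_minus: "bachelier_fun (- x) = bachelier_fun x - x"
  by (simp add: bachelier_fun_def std_normal_cdf_minus algebra_simps)

lemma DERIV_bachelier_fun: "(bachelier_fun has_real_derivative std_normal_cdf x) (at x)"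
  unfolding bachelier_fun_def
  by (auto intro!: derivative_eq_intros DERIV_std_normal_density DERIV_std_normal_cdf)

lemma mono_bachelier_fun: "mono bachelier_fun"
  using DERIV_bachelier_fun std_normal.cdf_nonneg
  by (intro monoI) (blast intro: DERIV_nonneg_imp_nondecreasing)

lemma bachelier_fun_nonneg: "0 \<le> bachelier_fun x"
proof -
  \<comment> \<open>Freezing the factor \<open>x\<close> gives a function that vanishes at minus
    infinity, increases up to \<open>t = x\<close> and equals \<open>bachelier_fun x\<close>
    there.\<close>
  let ?h = "\<lambda>t. std_normal_density t + x * std_normal_cdf t"
  have "(?h has_real_derivative (x - t) * std_normal_density t) (at t)" for t
    by (auto intro!: derivative_eq_intros DERIV_std_normal_density DERIV_std_normal_cdf
        simp: algebra_simps)
  then have le: "?h y \<le> bachelier_fun x" if "y \<le> x" for y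
    unfolding bachelier_fun_def using that
    by (intro DERIV_nonneg_imp_nondecreasing[of y x ?h]) (force intro!: mult_nonneg_nonneg)+
  have "(?h \<longlongrightarrow> 0 + x * 0) at_bot"
    by (intro tendsto_intros tendsto_std_normal_density_at_bot std_normal.cdf_lim_at_bot)
  then have "0 + x * 0 \<le> bachelier_fun x"
    by (rule tendsto_upperbound)
       (auto intro: eventually_mono[OF eventually_le_at_bot[of x]] le)
  then show ?thesis
    by simp
qed

text \<open>A zero at \<open>x\<close> would force zeros everywhere to its left. At the interior
  point \<open>x - 1\<close> the derivative, which is the cdf, would then vanish too, leaving only
  the positive density.\<close>

lemma bachelier_fun_pos: "0 < bachelier_fun x"
proof (rule ccontr)
  assume "\<not> 0 < bachelier_fun x"
  then have zero: "bachelier_fun t = 0" if "t \<le> x" for t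
    using that monoD[OF mono_bachelier_fun, of t x] bachelier_fun_nonneg[of t] by simp
  have "((\<lambda>_. 0) has_real_derivative std_normal_cdf (x - 1)) (at (x - 1))"
    by (rule has_field_derivative_transform_within_open[OF DERIV_bachelier_fun, where S="{..<x}"])
       (auto simp: zero)
  then have "std_normal_cdf (x - 1) = 0"
    using DERIV_const DERIV_unique by blast
  then show False
    using zero[of "x - 1"] normal_density_pos[of 1 0 "x - 1"] by (simp add: bachelier_fun_def)
qed

text \<open>The price at a fixed strike increases strictly with volatility, so implied volatility is
  unique. For \<open>d \<le> 0\<close> both factors are monotone in the volatility, the first one
  strictly.\<close>

lemma mult_bachelier_fun_strict_mono:
  assumes "0 < \<sigma>\<^sub>1" "\<sigma>\<^sub>1 < \<sigma>\<^sub>2"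
  shows "\<sigma>\<^sub>1 * bachelier_fun (d / \<sigma>\<^sub>1) < \<sigma>\<^sub>2 * bachelier_fun (d / \<sigma>\<^sub>2)"
proof -
  have neg: "\<sigma>\<^sub>1 * bachelier_fun (e / \<sigma>\<^sub>1) < \<sigma>\<^sub>2 * bachelier_fun (e / \<sigma>\<^sub>2)" if "e \<le> 0" for e
  proof -
    have "e / \<sigma>\<^sub>1 \<le> e / \<sigma>\<^sub>2"
      using assms that by (intro divide_left_mono_neg) auto
    then have "bachelier_fun (e / \<sigma>\<^sub>1) \<le> bachelier_fun (e / \<sigma>\<^sub>2)"
      by (rule monoD[OF mono_bachelier_fun])
    then show ?thesis
      using assms bachelier_fun_pos by (intro mult_less_le_imp_less) (auto simp: less_imp_le)
  qed
  show ?thesis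
  proof (cases "d \<le> 0")
    case False
    \<comment> \<open>By parity, the prices for \<open>d\<close> and \<open>- d\<close> differ by
      \<open>d\<close>, whatever the volatility.\<close>
    then show ?thesis
      using neg[of "- d"] assms by (simp add: bachelier_fun_minus algebra_simps)
  qed (rule neg)
qed

lemma bachelier_implied_vol_unique:
  assumes "is_bachelier_implied_vol F C K \<sigma>" "is_bachelier_implied_vol F C K \<sigma>'"
  shows "\<sigma> = \<sigma>'"
  using assms mult_bachelier_fun_strict_mono[of \<sigma> \<sigma>' "F - K"]
    mult_bachelier_fun_strict_mono[of \<sigma>' \<sigma> "F - K"]
  by (cases \<sigma> \<sigma>' rule: linorder_cases)
     (auto simp: is_bachelier_implied_vol_def bachelier_call_eq)

lemma bachelier_implied_vol_eq:
  assumes "is_bachelier_implied_vol F C K \<sigma>"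
  shows "bachelier_implied_vol F C K = \<sigma>"
  unfolding bachelier_implied_vol_def
  using assms by (blast intro: bachelier_implied_vol_unique)

text \<open>Here \<open>a\<close> and \<open>b\<close> are distances of out-of-the-money strikes
  from the forward, for calls or for puts. If \<open>b / t \<le> a / s\<close>, then
  \<open>a < b\<close> forces \<open>s < t\<close>, and the farther option would cost strictly
  more.\<close>

lemma less_if_mult_bachelier_fun_le:
  assumes "0 < s" "0 < t" "0 < a" "a < b"
    and le: "t * bachelier_fun (- (b / t)) \<le> s * bachelier_fun (- (a / s))"
  shows "a / s < b / t"
proof (rule ccontr)
  assume "\<not> a / s < b / t"
  then have ba: "b / t \<le> a / s"
    by simp
  then have "bachelier_fun (- (a / s)) \<le> bachelier_fun (- (b / t))"
    by (intro monoD[OF mono_bachelier_fun]) simp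
  moreover have "s < t"
  proof -
    have "s * b \<le> t * a"
      using ba assms by (simp add: field_simps)
    also have "\<dots> < t * b"
      using assms by simp
    finally show ?thesis
      using assms by simp
  qed
  ultimately have "s * bachelier_fun (- (a / s)) < t * bachelier_fun (- (b / t))"
    using assms bachelier_fun_pos by (intro mult_less_le_imp_less) (auto simp: less_imp_le)
  with le show False
    by simp
qed

lemma scaled_moneyness_strict_mono:
  assumes arb: "normal_no_arbitrage F C P" and "K\<^sub>1 < K\<^sub>2"
    and vol1: "is_bachelier_implied_vol F C K\<^sub>1 \<sigma>\<^sub>1" and vol2: "is_bachelier_implied_vol F C K\<^sub>2 \<sigma>\<^sub>2"
  shows "(K\<^sub>1 - F) / \<sigma>\<^sub>1 < (K\<^sub>2 - F) / \<sigma>\<^sub>2"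
proof -
  have pos: "0 < \<sigma>\<^sub>1" "0 < \<sigma>\<^sub>2"
    and call: "C K\<^sub>1 = \<sigma>\<^sub>1 * bachelier_fun (- ((K\<^sub>1 - F) / \<sigma>\<^sub>1))"
      "C K\<^sub>2 = \<sigma>\<^sub>2 * bachelier_fun (- ((K\<^sub>2 - F) / \<sigma>\<^sub>2))"
    using vol1 vol2
    by (auto simp: is_bachelier_implied_vol_def bachelier_call_eq minus_divide_left)
  \<comment> \<open>A strike equal to \<open>F\<close> falls into the first case, where signs
    decide; the other two thus have strictly positive distances from \<open>F\<close>.\<close>
  consider "K\<^sub>1 \<le> F" "F \<le> K\<^sub>2" | "F < K\<^sub>1" | "K\<^sub>2 < F"
    by linarith
  then show ?thesis
  proof cases
    case 1
    show ?thesis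
    proof (cases "K\<^sub>1 = F")
      case True
      then show ?thesis
        using \<open>K\<^sub>1 < K\<^sub>2\<close> pos by simp
    next
      case False
      then have "(K\<^sub>1 - F) / \<sigma>\<^sub>1 < 0"
        using 1 pos by (simp add: divide_neg_pos)
      also have "0 \<le> (K\<^sub>2 - F) / \<sigma>\<^sub>2"
        using 1 pos by simp
      finally show ?thesis .
    qed
  next
    case 2
    have "C K\<^sub>2 \<le> C K\<^sub>1"
      using arb \<open>K\<^sub>1 < K\<^sub>2\<close> by (auto simp: normal_no_arbitrage_def intro: antimonoD)
    then show ?thesis
      using 2 pos \<open>K\<^sub>1 < K\<^sub>2\<close> by (intro less_if_mult_bachelier_fun_le) (auto simp: call)
  next
    case 3
    have mono_P: "P K\<^sub>1 \<le> P K\<^sub>2"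
      using arb \<open>K\<^sub>1 < K\<^sub>2\<close> by (auto simp: normal_no_arbitrage_def intro: monoD)
    have parity: "C K - P K = F - K" for K
      using arb by (simp add: normal_no_arbitrage_def)
    \<comment> \<open>Parity gives the put the same form as the call, with the same volatility and
      the distance \<open>F - K\<close>.\<close>
    have put: "P K = \<sigma> * bachelier_fun (- ((F - K) / \<sigma>))"
      if "0 < \<sigma>" "C K = \<sigma> * bachelier_fun (- ((K - F) / \<sigma>))" for K \<sigma>
    proof -
      have "- ((K - F) / \<sigma>) = (F - K) / \<sigma>"
        by (simp add: minus_divide_left)
      then show ?thesis
        using that parity[of K] by (simp add: bachelier_fun_minus right_diff_distrib[of \<sigma> "bachelier_fun _"])
    qed
    \<comment> \<open>The strikes swap roles: below \<open>F\<close>, the nearer one is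
      \<open>K\<^sub>2\<close>, and put prices decrease with distance.\<close>
    have "(F - K\<^sub>2) / \<sigma>\<^sub>2 < (F - K\<^sub>1) / \<sigma>\<^sub>1"
      using 3 pos \<open>K\<^sub>1 < K\<^sub>2\<close>
      by (intro less_if_mult_bachelier_fun_le)
         (use mono_P in \<open>auto simp: put[OF pos(1) call(1)] put[OF pos(2) call(2)]\<close>)
    then show ?thesis
      by (simp add: diff_divide_distrib)
  qed
qed

theorem theorem3p2:
  fixes F :: real and C P :: "real \<Rightarrow> real"
  assumes "F > 0"
    and "normal_no_arbitrage F C P"
  shows "(\<forall>K\<^sub>1 K\<^sub>2 \<sigma>\<^sub>1 \<sigma>\<^sub>2.
            K\<^sub>1 < K\<^sub>2 \<longrightarrow>
            is_bachelier_implied_vol F C K\<^sub>1 \<sigma>\<^sub>1 \<longrightarrow>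
            is_bachelier_implied_vol F C K\<^sub>2 \<sigma>\<^sub>2 \<longrightarrow>
            (K\<^sub>1 - F) / \<sigma>\<^sub>1 < (K\<^sub>2 - F) / \<sigma>\<^sub>2) \<and>
         strict_antimono_on (implied_vol_strikes F C)
           (\<lambda>K. (F - K) / bachelier_implied_vol F C K)"
proof (intro conjI allI impI monotone_onI)
  show "(K\<^sub>1 - F) / \<sigma>\<^sub>1 < (K\<^sub>2 - F) / \<sigma>\<^sub>2"
    if "K\<^sub>1 < K\<^sub>2" "is_bachelier_implied_vol F C K\<^sub>1 \<sigma>\<^sub>1" "is_bachelier_implied_vol F C K\<^sub>2 \<sigma>\<^sub>2"
    for K\<^sub>1 K\<^sub>2 \<sigma>\<^sub>1 \<sigma>\<^sub>2
    using assms(2) that by (rule scaled_moneyness_strict_mono)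
next
  fix K\<^sub>1 K\<^sub>2
  assume "K\<^sub>1 \<in> implied_vol_strikes F C" "K\<^sub>2 \<in> implied_vol_strikes F C" and less: "K\<^sub>1 < K\<^sub>2"
  then obtain \<sigma>\<^sub>1 \<sigma>\<^sub>2 where vol: "is_bachelier_implied_vol F C K\<^sub>1 \<sigma>\<^sub>1"
    "is_bachelier_implied_vol F C K\<^sub>2 \<sigma>\<^sub>2"
    by (auto simp: implied_vol_strikes_def)
  \<comment> \<open>By uniqueness, the volatilities obtained here are the values of
    \<open>bachelier_implied_vol\<close>.\<close>
  from scaled_moneyness_strict_mono[OF assms(2) less vol]
  show "(F - K\<^sub>2) / bachelier_implied_vol F C K\<^sub>2 < (F - K\<^sub>1) / bachelier_implied_vol F C K\<^sub>1"
    using vol by (simp add: bachelier_implied_vol_eq diff_divide_distrib)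
qed

end
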